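(* Let $\alpha = \sqrt[40]{\theta(40)}$, where $\theta(40) = 22388184630824$. Then for every fixed integer $p \geq 5$, \[ \lim_{n\to\infty} \frac{\theta(n)}{n^p\,\alpha^n} = \infty. \]
   Context: For a positive integer $n$, let $[n]=\{1,2,\ldots,n\}$. A permutation $(a_1,a_2,\ldots,a_n)$ of $[n]$ is called 3-free if there do not exist indices $i<j<k$ with $a_i + a_k = 2a_j$, i.e., it contains no 3-term arithmetic progression as a subsequence. $\theta(n)$ denotes the number of 3-free permutations of $[n]$. *)

theory Defs
  imports Complex_Main "HOL-Combinatorics.Multiset_Permutations"
begin

definition three_free :: "nat list \<Rightarrow> bool" where
  "three_free a \<longleftrightarrow>
     \<not> (\<exists>i j k. i < j \<and> j < k \<and> k < length a \<and> a ! i + a ! k = 2 * a ! j)"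

text \<open>
  A permutation of \<open>{1..n}\<close> is given in one-line notation, as a list in
  \<^term>\<open>permutations_of_set {1..n}\<close>; list positions start at 0 while the entries
  are \<open>1, \<dots>, n\<close>.
\<close>

definition theta :: "nat \<Rightarrow> nat"  ("\<theta>") where
  "\<theta> n = card {a \<in> permutations_of_set {1..n}. three_free a}"

end

theory Submission
  imports Defs
begin

text \<open>
  Build a 3-free permutation of \<open>{1..n}\<close> from left to right. Writing down \<open>x\<close> after the entries in
  the set \<open>S\<close> is harmless iff \<open>S\<close> is symmetric about \<open>x\<close> inside \<open>{1..n}\<close>, so \<open>\<theta> n\<close> counts the paths
  from \<open>{}\<close> to \<open>{1..n}\<close> in a graph of sets. Few sets lie on such a path (are live): the odd and the
  even entries of a 3-free permutation are again 3-free permutations, so the traces of a live set on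
  the odd and on the even numbers are live for \<open>(n + 1) div 2\<close> and \<open>n div 2\<close>. As the reversal of a
  3-free permutation is 3-free, complements of live sets are live. Searching the graph level by level
  and dropping the sets that violate these conditions visits only a few thousand sets for \<open>n = 40\<close>, few enough for
  the simplifier.

  For the limit, a permutation of the odd numbers followed by one of the even numbers (or conversely)
  is 3-free if both parts are, so \<open>g n = 2 \<theta> n\<close> satisfies \<open>g (m + k) \<ge> g m g k\<close> for \<open>m - k \<in> {0, 1}\<close>. Hence a bound
  \<open>g n \<ge> \<beta>\<^sup>n\<close> for \<open>11 \<le> n < 22\<close> holds for all \<open>n \<ge> 11\<close>, and it holds for some \<open>\<beta> > \<alpha>\<close>.
\<close>

section \<open>Prefix sets of 3-free permutations\<close>

text \<open>A progression is tested when its middle term \<open>x\<close> is written: it arises iff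
  exactly one of \<open>x - d\<close>, \<open>x + d\<close> already stands in \<open>S\<close>, the
  other following later. The bounds on \<open>d\<close> keep both in \<open>{1..n}\<close>.\<close>

definition admits :: "nat \<Rightarrow> nat set \<Rightarrow> nat \<Rightarrow> bool" where
  "admits n S x \<longleftrightarrow> x \<in> {1..n} \<and> x \<notin> S \<and>
     (\<forall>d. 0 < d \<longrightarrow> d < x \<longrightarrow> x + d \<le> n \<longrightarrow> (x - d \<in> S \<longleftrightarrow> x + d \<in> S))"

definition move :: "nat \<Rightarrow> nat set \<Rightarrow> nat set \<Rightarrow> bool" where
  "move n S T \<longleftrightarrow> (\<exists>x. admits n S x \<and> T = insert x S)"

definition live :: "nat \<Rightarrow> nat set \<Rightarrow> bool" where
  "live n S \<longleftrightarrow> (move n)\<^sup>*\<^sup>* {} S \<and> (move n)\<^sup>*\<^sup>* S {1..n}"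

text \<open>\<open>Q\<close> is tested on the set after each addition but not on the starting set,
  just as the search prunes a level right after producing it.\<close>

primrec completions :: "nat \<Rightarrow> (nat set \<Rightarrow> bool) \<Rightarrow> nat \<Rightarrow> nat set \<Rightarrow> nat" where
  "completions n Q 0 S = 1"
| "completions n Q (Suc k) S =
     (\<Sum>x | admits n S x. of_bool (Q (insert x S)) * completions n Q k (insert x S))"

primrec valid :: "nat \<Rightarrow> nat set \<Rightarrow> nat list \<Rightarrow> bool" where
  "valid n S [] \<longleftrightarrow> True"
| "valid n S (x # xs) \<longleftrightarrow> admits n S x \<and> valid n (insert x S) xs"

lemma finite_admits [simp]: "finite {x. admits n S x}"
  by (rule finite_subset[of _ "{1..n}"]) (auto simp: admits_def)

lemma finite_valid: "finite {xs. length xs = k \<and> valid n S xs}"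
proof (induction k arbitrary: S)
  case (Suc k)
  have "{xs. length xs = Suc k \<and> valid n S xs}
      = (\<Union>x\<in>{x. admits n S x}. (#) x ` {xs. length xs = k \<and> valid n (insert x S) xs})"
    by (auto simp: length_Suc_conv)
  then show ?case using Suc by simp
qed auto

lemma card_valid: "card {xs. length xs = k \<and> valid n S xs} = completions n (\<lambda>_. True) k S"
proof (induction k arbitrary: S)
  case 0
  have "{xs. length xs = 0 \<and> valid n S xs} = {[]}" by auto
  then show ?case by simp
next
  case (Suc k)
  have "{xs. length xs = Suc k \<and> valid n S xs}
      = (\<Union>x\<in>{x. admits n S x}. (#) x ` {xs. length xs = k \<and> valid n (insert x S) xs})"
    by (auto simp: length_Suc_conv)
  also have "card \<dots> = (\<Sum>x | admits n S x. card ((#) x ` {xs. length xs = k \<and> valid n (insert x S) xs}))"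
    by (rule card_UN_disjoint) (auto intro: finite_valid)
  also have "\<dots> = (\<Sum>x | admits n S x. completions n (\<lambda>_. True) k (insert x S))"
    by (intro sum.cong refl) (simp add: card_image Suc)
  finally show ?case by simp
qed

lemma valid_iff_nth:
  "valid n S xs \<longleftrightarrow> (\<forall>j<length xs. admits n (S \<union> set (take j xs)) (xs ! j))"
proof (induction xs arbitrary: S)
  case (Cons x xs)
  show ?case
    by (simp add: Cons All_less_Suc2)
qed simp

lemma valid_imp_distinct:
  assumes "valid n S xs"
  shows "distinct xs \<and> set xs \<subseteq> {1..n} \<and> set xs \<inter> S = {}"
  using assms by (induction xs arbitrary: S) (auto simp: admits_def)

text \<open>A progression with middle position \<open>j\<close> breaks the symmetry of the first
  \<open>j\<close> entries about \<open>xs ! j\<close>. Conversely, a broken symmetry puts one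
  mirror image before \<open>j\<close> and, since all of \<open>{1..n}\<close> gets written, the
  other after it.\<close>

lemma valid_iff_three_free:
  "length xs = n \<and> valid n {} xs \<longleftrightarrow> xs \<in> permutations_of_set {1..n} \<and> three_free xs"
proof (intro iffI conjI)
  assume *: "length xs = n \<and> valid n {} xs"
  then have d: "distinct xs" and s: "set xs \<subseteq> {1..n}" using valid_imp_distinct by blast+
  have "set xs = {1..n}"
    using * d s by (intro card_subset_eq) (auto simp: distinct_card)
  with d show "xs \<in> permutations_of_set {1..n}" by (simp add: permutations_of_set_def)
  show "three_free xs"
    unfolding three_free_def
  proof (clarify)
    fix i j k assume ijk: "i < j" "j < k" "k < length xs" and eq: "xs ! i + xs ! k = 2 * xs ! j"
    have adm: "admits n (set (take j xs)) (xs ! j)"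
      using * ijk by (simp add: valid_iff_nth)
    have i: "xs ! i \<in> set (take j xs)" using ijk by (auto simp: in_set_conv_nth intro!: exI[of _ i])
    have k: "xs ! k \<notin> set (take j xs)" using ijk d by (auto simp: in_set_conv_nth nth_eq_iff_index_eq)
    have ne: "xs ! i \<noteq> xs ! j" "xs ! k \<noteq> xs ! j" using ijk d by (auto simp: nth_eq_iff_index_eq)
    have r: "xs ! i \<in> {1..n}" "xs ! k \<in> {1..n}" using s ijk by (auto simp: subset_iff)
    have sym: "\<And>d. 0 < d \<Longrightarrow> d < xs ! j \<Longrightarrow> xs ! j + d \<le> n \<Longrightarrow>
        (xs ! j - d \<in> set (take j xs) \<longleftrightarrow> xs ! j + d \<in> set (take j xs))"
      using adm by (auto simp: admits_def)
    show False
    proof (cases "xs ! i < xs ! j")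
      case True
      then have "xs ! j - (xs ! j - xs ! i) = xs ! i" "xs ! j + (xs ! j - xs ! i) = xs ! k"
        using eq by linarith+
      then show False using sym[of "xs ! j - xs ! i"] True r i k by simp
    next
      case False
      then have "xs ! k < xs ! j" using eq ne by linarith
      then have "xs ! j - (xs ! j - xs ! k) = xs ! k" "xs ! j + (xs ! j - xs ! k) = xs ! i"
        using eq by linarith+
      then show False using sym[of "xs ! j - xs ! k"] \<open>xs ! k < xs ! j\<close> r i k by simp
    qed
  qed
next
  assume *: "xs \<in> permutations_of_set {1..n} \<and> three_free xs"
  then have d: "distinct xs" and s: "set xs = {1..n}" by (auto simp: permutations_of_set_def)
  show len: "length xs = n" using distinct_card[OF d] s by simp
  show "valid n {} xs"
    unfolding valid_iff_nth admits_def
  proof (intro allI impI conjI)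
    fix j assume j: "j < length xs"
    show "xs ! j \<in> {1..n}" using s j nth_mem by blast
    show "xs ! j \<notin> {} \<union> set (take j xs)" using d j by (auto simp: in_set_conv_nth nth_eq_iff_index_eq)
    fix e assume e: "0 < e" "e < xs ! j" "xs ! j + e \<le> n"
    have later: "\<exists>k>j. k < length xs \<and> xs ! k = y" if "y \<in> {1..n}" "y \<notin> set (take j xs)" "y \<noteq> xs ! j" for y
    proof -
      have "y \<in> set xs" using that(1) s by simp
      then obtain k where k: "k < length xs" "xs ! k = y" by (auto simp: in_set_conv_nth)
      then have "\<not> k < j" using that(2) j by (auto simp: in_set_conv_nth)
      then show ?thesis using k that(3) by (cases j k rule: linorder_cases) auto
    qed
    have earlier: "\<exists>i<j. xs ! i = y" if "y \<in> set (take j xs)" for y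
      using that j by (auto simp: in_set_conv_nth)
    have free: "\<And>i k. i < j \<Longrightarrow> j < k \<Longrightarrow> k < length xs \<Longrightarrow> xs ! i + xs ! k \<noteq> 2 * xs ! j"
      using * by (auto simp: three_free_def)
    show "xs ! j - e \<in> {} \<union> set (take j xs) \<longleftrightarrow> xs ! j + e \<in> {} \<union> set (take j xs)"
    proof (rule ccontr)
      assume "\<not> ?thesis"
      then consider "xs ! j - e \<in> set (take j xs)" "xs ! j + e \<notin> set (take j xs)"
        | "xs ! j - e \<notin> set (take j xs)" "xs ! j + e \<in> set (take j xs)" by auto
      then show False
      proof cases
        case 1
        obtain i where "i < j" "xs ! i = xs ! j - e" using earlier 1 by blast
        moreover obtain k where "k > j" "k < length xs" "xs ! k = xs ! j + e"
          using later[of "xs ! j + e"] 1 e by auto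
        ultimately show False using free[of i k] e by simp
      next
        case 2
        obtain i where "i < j" "xs ! i = xs ! j + e" using earlier 2 by blast
        moreover have "1 \<le> xs ! j - e" "xs ! j - e \<le> n" "xs ! j - e \<noteq> xs ! j" using e by linarith+
        then obtain k where "k > j" "k < length xs" "xs ! k = xs ! j - e"
          using later[of "xs ! j - e"] 2 by auto
        ultimately show False using free[of i k] e by simp
      qed
    qed
  qed
qed

lemma theta_eq_completions: "\<theta> n = completions n (\<lambda>_. True) n {}"
  unfolding theta_def card_valid[symmetric] valid_iff_three_free by simp

section \<open>Pruning to live sets\<close>

lemma move_subset: "(move n)\<^sup>*\<^sup>* S T \<Longrightarrow> S \<subseteq> {1..n} \<Longrightarrow> T \<subseteq> {1..n}"
  by (induction rule: rtranclp_induct) (auto simp: move_def admits_def)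

text \<open>By the cardinality condition \<open>k\<close> additions end in \<open>{1..n}\<close>, so
  anything counted would be a path from \<open>S\<close> to \<open>{1..n}\<close>.\<close>

lemma completions_eq_0:
  assumes "S \<subseteq> {1..n}" "card S + k = n" "\<not> (move n)\<^sup>*\<^sup>* S {1..n}"
  shows "completions n Q k S = 0"
  using assms
proof (induction k arbitrary: S)
  case 0
  then have "S = {1..n}" by (intro card_subset_eq) auto
  then show ?case using 0 by simp
next
  case (Suc k)
  have "completions n Q k (insert x S) = 0" if x: "admits n S x" for x
  proof (rule Suc.IH)
    show "insert x S \<subseteq> {1..n}" using x Suc.prems by (auto simp: admits_def)
    have "finite S" using Suc.prems finite_subset by blast
    then show "card (insert x S) + k = n" using x Suc.prems by (simp add: admits_def)
    have "move n S (insert x S)" using x by (auto simp: move_def)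
    then show "\<not> (move n)\<^sup>*\<^sup>* (insert x S) {1..n}"
      using Suc.prems(3) by (meson converse_rtranclp_into_rtranclp)
  qed
  then show ?case by simp
qed

text \<open>Pruning drops only summands that vanish: a reachable set failing \<open>Q\<close> is not
  live, hence cannot be completed.\<close>

lemma completions_prune:
  assumes "\<And>T. live n T \<Longrightarrow> Q T" "(move n)\<^sup>*\<^sup>* {} S" "card S + k = n"
  shows "completions n Q k S = completions n (\<lambda>_. True) k S"
  using assms(2-)
proof (induction k arbitrary: S)
  case (Suc k)
  have S: "S \<subseteq> {1..n}" using move_subset Suc.prems(1) by blast
  have "of_bool (Q (insert x S)) * completions n Q k (insert x S) = completions n (\<lambda>_. True) k (insert x S)"
    if x: "admits n S x" for x
  proof -
    have T: "(move n)\<^sup>*\<^sup>* {} (insert x S)"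
      using Suc.prems(1) by (rule rtranclp.rtrancl_into_rtrancl) (use x in \<open>auto simp: move_def\<close>)
    have c: "card (insert x S) + k = n" using x Suc.prems S
      by (simp add: admits_def finite_subset[OF S])
    show ?thesis
    proof (cases "live n (insert x S)")
      case True
      then show ?thesis using assms(1) Suc.IH[OF T c] by simp
    next
      case False
      then have "\<not> (move n)\<^sup>*\<^sup>* (insert x S) {1..n}" using T by (simp add: live_def)
      then show ?thesis using completions_eq_0[OF _ c] x S by (simp add: admits_def)
    qed
  qed
  then show ?case by simp
qed simp

lemma theta_eq_pruned:
  assumes "\<And>T. live n T \<Longrightarrow> Q T"
  shows "\<theta> n = completions n Q n {}"
  unfolding theta_eq_completions by (rule completions_prune[symmetric]) (use assms in auto)

section \<open>Complements and parity traces of live sets\<close>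

lemma live_between:
  assumes "(move n)\<^sup>*\<^sup>* {} S" "(move n)\<^sup>*\<^sup>* S T" "live n T"
  shows "live n S"
  using assms by (auto simp: live_def intro: rtranclp_trans)

text \<open>Symmetry about \<open>x\<close> passes to the complement in \<open>{1..n}\<close>, so
  adding \<open>x\<close>, read backwards on complements, is again a move.\<close>

lemma move_complement:
  assumes "move n S T" "S \<subseteq> {1..n}"
  shows "move n ({1..n} - T) ({1..n} - S)"
proof -
  obtain x where x: "admits n S x" "T = insert x S" using assms(1) by (auto simp: move_def)
  have "admits n ({1..n} - T) x"
    using x by (auto simp: admits_def)
  moreover have "{1..n} - S = insert x ({1..n} - T)" using x by (auto simp: admits_def)
  ultimately show ?thesis by (auto simp: move_def)
qed

lemma moves_complement:
  assumes "(move n)\<^sup>*\<^sup>* S T" "S \<subseteq> {1..n}"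
  shows "(move n)\<^sup>*\<^sup>* ({1..n} - T) ({1..n} - S)"
  using assms
proof (induction rule: rtranclp_induct)
  case (step T U)
  then have "move n ({1..n} - U) ({1..n} - T)" by (intro move_complement move_subset[of n S T])
  with step show ?case by (meson converse_rtranclp_into_rtranclp)
qed simp

lemma live_complement:
  assumes "live n S"
  shows "live n ({1..n} - S)"
  using moves_complement[of n "{}" S] moves_complement[of n S "{1..n}"] assms move_subset[of n "{}" S]
  by (auto simp: live_def)

text \<open>\<open>r = 1\<close> gives the trace on the odd numbers, \<open>r = 0\<close> the one on
  the even numbers. Distance \<open>d\<close> in the trace is distance \<open>2 * d\<close> in
  \<open>{1..n}\<close>, so symmetry is inherited. An entry outside the range of \<open>g\<close>
  leaves the trace unchanged, whence the reflexive closure.\<close>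

lemma move_restrict:
  assumes g: "\<And>i. g i = 2 * i - r" "r \<le> 1" and m: "\<And>i. i \<in> {1..m} \<longleftrightarrow> 1 \<le> i \<and> g i \<in> {1..n}"
    and "move n S T"
  shows "(move m)\<^sup>*\<^sup>* {i \<in> {1..m}. g i \<in> S} {i \<in> {1..m}. g i \<in> T}"
proof -
  obtain x where x: "admits n S x" "T = insert x S" using assms by (auto simp: move_def)
  show ?thesis
  proof (cases "\<exists>i\<in>{1..m}. g i = x")
    case True
    then obtain i where i: "i \<in> {1..m}" "g i = x" by blast
    have adm: "admits m {i \<in> {1..m}. g i \<in> S} i"
      unfolding admits_def
    proof (intro conjI allI impI)
      show "i \<in> {1..m}" by fact
      show "i \<notin> {i \<in> {1..m}. g i \<in> S}" using i x by (auto simp: admits_def)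
      fix d assume d: "0 < d" "d < i" "i + d \<le> m"
      have mem: "i + d \<in> {1..m}" "i - d \<in> {1..m}" using d by auto
      then have "g (i + d) \<in> {1..n}" "g (i - d) \<in> {1..n}" using m by blast+
      moreover have "g (i - d) = x - 2 * d" "g (i + d) = x + 2 * d" using d i g by auto
      \<comment> \<open>As \<open>g (i - d)\<close> is at least 1, the difference
        \<open>x - 2 * d\<close> is not truncated.\<close>
      moreover have "2 * d < x" using calculation(2,3) unfolding atLeastAtMost_iff by linarith
      moreover note mem
      ultimately show "i - d \<in> {i \<in> {1..m}. g i \<in> S} \<longleftrightarrow> i + d \<in> {i \<in> {1..m}. g i \<in> S}"
        using x(1)[unfolded admits_def, THEN conjunct2, THEN conjunct2, rule_format, of "2 * d"] d by simp
    qed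
    have "j = i" if "j \<in> {1..m}" "g j = x" for j
      using that i g by auto
    then have "{i \<in> {1..m}. g i \<in> T} = insert i {i \<in> {1..m}. g i \<in> S}"
      using i x by blast
    then have "move m {i \<in> {1..m}. g i \<in> S} {i \<in> {1..m}. g i \<in> T}"
      unfolding move_def using adm by (intro exI[of _ i] conjI)
    then show ?thesis by (rule r_into_rtranclp)
  next
    case False
    then have "{i \<in> {1..m}. g i \<in> T} = {i \<in> {1..m}. g i \<in> S}" using x by auto
    then show ?thesis by simp
  qed
qed

lemma live_restrict:
  assumes g: "\<And>i. g i = 2 * i - r" "r \<le> 1" and m: "\<And>i. i \<in> {1..m} \<longleftrightarrow> 1 \<le> i \<and> g i \<in> {1..n}"
    and "live n S"
  shows "live m {i \<in> {1..m}. g i \<in> S}"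
proof -
  have *: "(move m)\<^sup>*\<^sup>* {i \<in> {1..m}. g i \<in> A} {i \<in> {1..m}. g i \<in> B}" if "(move n)\<^sup>*\<^sup>* A B" for A B
    using that
  proof (induction rule: rtranclp_induct)
    case (step B C)
    then show ?case using move_restrict[OF g m] by (meson rtranclp_trans)
  qed simp
  have "{i \<in> {1..m}. g i \<in> {1..n}} = {1..m}" using m by blast
  then show ?thesis using *[of "{}" S] *[of S "{1..n}"] \<open>live n S\<close> by (simp add: live_def)
qed

section \<open>Tries of weighted sets\<close>

text \<open>The characteristic string of a subset of \<open>{1..n}\<close>, beginning with the
  number 1; \<open>size\<close> recovers \<open>n\<close>.\<close>

datatype bits = End | Out bits | In bits

text \<open>
  A trie maps bit strings to positive counts; a \<open>Leaf\<close> carries the unbranched rest of its key.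
\<close>
datatype trie = Empty | Leaf bits num | Node trie trie

primrec elems :: "bits \<Rightarrow> nat set" where
  "elems End = {}"
| "elems (Out b) = Suc ` elems b"
| "elems (In b) = insert 1 (Suc ` elems b)"

primrec out_bits :: "nat \<Rightarrow> bits" where
  "out_bits 0 = End"
| "out_bits (Suc n) = Out (out_bits n)"

primrec rev_append :: "bits \<Rightarrow> bits \<Rightarrow> bits" where
  "rev_append End b = b"
| "rev_append (Out a) b = rev_append a (Out b)"
| "rev_append (In a) b = rev_append a (In b)"

text \<open>Comparison stops with the shorter string, where \<open>x - d\<close> or
  \<open>x + d\<close> leaves \<open>{1..n}\<close>.\<close>

fun mirrored :: "bits \<Rightarrow> bits \<Rightarrow> bool" where
  "mirrored End b = True"
| "mirrored a End = True"
| "mirrored (Out a) (Out b) = mirrored a b"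
| "mirrored (In a) (In b) = mirrored a b"
| "mirrored a b = False"

primrec keys :: "trie \<Rightarrow> bits set" where
  "keys Empty = {}"
| "keys (Leaf b c) = {b}"
| "keys (Node l r) = Out ` keys l \<union> In ` keys r"

text \<open>Two uses: the constant 1 as \<open>h\<close> gives the number of paths, an indicator
  function gives membership.\<close>

primrec wsum :: "(bits \<Rightarrow> nat) \<Rightarrow> trie \<Rightarrow> nat" where
  "wsum h Empty = 0"
| "wsum h (Leaf b c) = nat_of_num c * h b"
| "wsum h (Node l r) = wsum (\<lambda>b. h (Out b)) l + wsum (\<lambda>b. h (In b)) r"

primrec uniform :: "nat \<Rightarrow> trie \<Rightarrow> bool" where
  "uniform n Empty = True"
| "uniform n (Leaf b c) = (size b = n)"
| "uniform n (Node l r) = (0 < n \<and> uniform (n - 1) l \<and> uniform (n - 1) r)"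

text \<open>
  All keys of a trie have the same length, so the last clause is never used.
\<close>
fun add_key :: "bits \<Rightarrow> num \<Rightarrow> trie \<Rightarrow> trie" where
  "add_key b c Empty = Leaf b c"
| "add_key (Out b) c (Node l r) = Node (add_key b c l) r"
| "add_key (In b) c (Node l r) = Node l (add_key b c r)"
| "add_key (Out b) c (Leaf (Out b') c') = Node (add_key b c (Leaf b' c')) Empty"
| "add_key (In b) c (Leaf (In b') c') = Node Empty (add_key b c (Leaf b' c'))"
| "add_key (Out b) c (Leaf (In b') c') = Node (Leaf b c) (Leaf b' c')"
| "add_key (In b) c (Leaf (Out b') c') = Node (Leaf b' c') (Leaf b c)"
| "add_key b c (Leaf b' c') = Leaf b (c + c')"
| "add_key End c (Node l r) = Node l r"

fun merge :: "trie \<Rightarrow> trie \<Rightarrow> trie" where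
  "merge Empty t = t"
| "merge (Leaf b c) t = add_key b c t"
| "merge (Node l r) Empty = Node l r"
| "merge (Node l r) (Leaf b c) = add_key b c (Node l r)"
| "merge (Node l r) (Node l' r') = Node (merge l l') (merge r r')"

text \<open>A conditional with one equation per truth value, suited to evaluation by rewriting;
  \<open>leaf_if\<close> is of the same kind.\<close>

primrec add_if :: "bool \<Rightarrow> bits \<Rightarrow> num \<Rightarrow> trie \<Rightarrow> trie" where
  "add_if True b c t = add_key b c t"
| "add_if False b c t = t"

text \<open>
  The set is \<open>rev_append a b\<close>: \<open>a\<close> is the part already scanned, in reverse order, so that symmetry
  about the current position is a comparison of \<open>a\<close> with the rest of the string.
\<close>
primrec successors :: "bits \<Rightarrow> bits \<Rightarrow> num \<Rightarrow> trie" where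
  "successors a End c = Empty"
| "successors a (Out b) c =
     add_if (mirrored a b) (rev_append a (In b)) c (successors (Out a) b c)"
| "successors a (In b) c = successors (In a) b c"

text \<open>\<open>p\<close> is the path from the root, reversed; at a leaf
  \<open>rev_append\<close> restores the whole key. \<open>merge\<close> adds up the counts of a set
  reached from several predecessors.\<close>

primrec expand :: "bits \<Rightarrow> trie \<Rightarrow> trie" where
  "expand p Empty = Empty"
| "expand p (Leaf b c) = successors End (rev_append p b) c"
| "expand p (Node l r) = merge (expand (Out p) l) (expand (In p) r)"

fun out_child :: "trie \<Rightarrow> trie" where
  "out_child (Node l r) = l"
| "out_child (Leaf (Out b) c) = Leaf b c"
| "out_child t = Empty"

fun in_child :: "trie \<Rightarrow> trie" where
  "in_child (Node l r) = r"
| "in_child (Leaf (In b) c) = Leaf b c"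
| "in_child t = Empty"

primrec nonempty :: "trie \<Rightarrow> bool" where
  "nonempty Empty = False"
| "nonempty (Leaf b c) = True"
| "nonempty (Node l r) = True"

text \<open>
  Looks up the complement of the odd positions of the string in \<open>s\<close> and that of the even positions
  in \<open>t\<close>. The tries swap roles at each bit, and complementing swaps the children. The complement is
  what matters: for a reachable set the traces themselves are reachable anyway.
\<close>
primrec admissible :: "bits \<Rightarrow> trie \<Rightarrow> trie \<Rightarrow> bool" where
  "admissible End s t = (nonempty s \<and> nonempty t)"
| "admissible (Out b) s t = admissible b t (in_child s)"
| "admissible (In b) s t = admissible b t (out_child s)"

text \<open>Restores the compressed form after pruning: two empty children vanish, and a single leaf
  absorbs the bit.\<close>

fun node :: "trie \<Rightarrow> trie \<Rightarrow> trie" where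
  "node Empty Empty = Empty"
| "node Empty (Leaf b c) = Leaf (In b) c"
| "node (Leaf b c) Empty = Leaf (Out b) c"
| "node l r = Node l r"

primrec leaf_if :: "bool \<Rightarrow> bits \<Rightarrow> num \<Rightarrow> trie" where
  "leaf_if True b c = Leaf b c"
| "leaf_if False b c = Empty"

text \<open>Filters by \<open>admissible\<close>, descending in \<open>s\<close> and
  \<open>t\<close> along with the trie, so that a shared prefix is looked up only once.\<close>

primrec prune :: "trie \<Rightarrow> trie \<Rightarrow> trie \<Rightarrow> trie" where
  "prune Empty s t = Empty"
| "prune (Leaf b c) s t = leaf_if (admissible b s t) b c"
| "prune (Node l r) s t = node (prune l t (in_child s)) (prune r t (out_child s))"

text \<open>For lookups only membership matters; resetting the counts keeps the numerals
  small.\<close>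

primrec forget_counts :: "trie \<Rightarrow> trie" where
  "forget_counts Empty = Empty"
| "forget_counts (Leaf b c) = Leaf b num.One"
| "forget_counts (Node l r) = Node (forget_counts l) (forget_counts r)"

definition next_level :: "trie \<Rightarrow> trie \<Rightarrow> trie \<Rightarrow> trie" where
  "next_level s t x = prune (expand End x) s t"

primrec advance :: "nat \<Rightarrow> trie \<Rightarrow> trie \<Rightarrow> trie \<Rightarrow> trie" where
  "advance 0 s t x = x"
| "advance (Suc k) s t x = advance k s t (next_level s t x)"

primrec visited :: "nat \<Rightarrow> trie \<Rightarrow> trie \<Rightarrow> trie \<Rightarrow> trie" where
  "visited 0 s t x = forget_counts x"
| "visited (Suc k) s t x = merge (forget_counts x) (visited k s t (next_level s t x))"

text \<open>
  A superset of the live sets of \<open>{1..n}\<close>, by recursion on the odd and the even part.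
\<close>
fun states :: "nat \<Rightarrow> trie" where
  "states n = (if n = 0 then Leaf End num.One else if n = 1 then Node (Leaf End num.One) (Leaf End num.One)
     else visited n (states ((n + 1) div 2)) (states (n div 2)) (Leaf (out_bits n) num.One))"
declare states.simps [simp del]

section \<open>Bit strings as sets\<close>

lemma zero_notin_elems [simp]: "0 \<notin> elems b"
  by (induction b) auto

lemma Suc_mem_elems [simp]:
  "Suc x \<in> elems (Out b) \<longleftrightarrow> x \<in> elems b"
  "Suc x \<in> elems (In b) \<longleftrightarrow> x = 0 \<or> x \<in> elems b"
  by auto

declare elems.simps(2,3) [simp del]

lemma elems_subset: "elems b \<subseteq> {1..size b}"
  by (induction b) (auto simp: elems.simps)

lemma elems_out_bits [simp]: "elems (out_bits n) = {}" and size_out_bits [simp]: "size (out_bits n) = n"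
  by (induction n) (auto simp: elems.simps)

text \<open>Membership of 1 determines the first bit, and shifting determines the rest. Together
  with \<open>ex_bits\<close>, strings of length \<open>n\<close> correspond bijectively to subsets
  of \<open>{1..n}\<close>.\<close>

lemma elems_inj: "size a = size b \<Longrightarrow> elems a = elems b \<Longrightarrow> a = b"
proof (induction a arbitrary: b)
  case (Out a)
  have "1 \<notin> elems b" using Out.prems by (metis One_nat_def Suc_mem_elems(1) zero_notin_elems)
  then have "\<exists>b'. b = Out b'"
    by (cases b) (use Out.prems Suc_mem_elems(2)[of 0] in auto)
  then obtain b' where "b = Out b'" ..
  with Out show ?case by (auto simp: elems.simps inj_image_eq_iff)
next
  case (In a)
  have 1: "1 \<in> elems b" using In.prems by (metis One_nat_def Suc_mem_elems(2))
  then have "\<exists>b'. b = In b'"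
    by (cases b) (use Suc_mem_elems(1)[of 0] in auto)
  then obtain b' where b: "b = In b'" ..
  have "x \<in> elems a \<longleftrightarrow> x \<in> elems b'" for x
    using In.prems(2) b Suc_mem_elems(2)[of x a] Suc_mem_elems(2)[of x b'] by (cases x) auto
  with In b show ?case by auto
next
  case End
  then show ?case by (cases b) auto
qed

lemma ex_bits: "S \<subseteq> {1..n} \<Longrightarrow> \<exists>b. size b = n \<and> elems b = S"
proof (induction n arbitrary: S)
  case 0
  then show ?case by (intro exI[of _ End]) auto
next
  case (Suc n)
  obtain b where b: "size b = n" "elems b = {x. x \<noteq> 0 \<and> Suc x \<in> S}"
    using Suc.IH[of "{x. x \<noteq> 0 \<and> Suc x \<in> S}"] Suc.prems by (force simp: subset_iff)
  define b' where "b' = (if 1 \<in> S then In b else Out b)"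
  have "x \<in> elems b' \<longleftrightarrow> x \<in> S" for x
    using b Suc.prems by (cases x) (auto simp: b'_def subset_iff)
  then have "elems b' = S" by blast
  moreover have "size b' = Suc n" using b(1) by (simp add: b'_def)
  ultimately show ?case by blast
qed

lemma size_rev_append [simp]: "size (rev_append a b) = size a + size b"
  by (induction a arbitrary: b) auto

text \<open>The head of \<open>a\<close> comes to stand at position \<open>size a\<close>, next to
  \<open>b\<close>. For \<open>x = 0\<close> both sides are false, as \<open>Suc (size a)\<close>
  exceeds all elements of \<open>elems a\<close>.\<close>

lemma mem_elems_rev_append:
  "x \<in> elems (rev_append a b) \<longleftrightarrow>
     (if x \<le> size a then Suc (size a) - x \<in> elems a else x - size a \<in> elems b)"
proof (induction a arbitrary: b x)
  case (Out a)
  consider "x \<le> size a" | "x = Suc (size a)" | y where "x = Suc (size a) + Suc y"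
    using less_imp_Suc_add[of "Suc (size a)" x] by fastforce
  then show ?case by cases (auto simp: Out Suc_diff_le)
next
  case (In a)
  consider "x \<le> size a" | "x = Suc (size a)" | y where "x = Suc (size a) + Suc y"
    using less_imp_Suc_add[of "Suc (size a)" x] by fastforce
  then show ?case by cases (auto simp: In Suc_diff_le)
qed (auto simp: not_le)

lemma all_nat_Suc: "(\<forall>i. P i) \<longleftrightarrow> P 0 \<and> (\<forall>i. P (Suc i))"
  by (metis not0_implies_Suc)

lemma mirrored_iff:
  "mirrored a b \<longleftrightarrow> (\<forall>i. i \<le> size a \<longrightarrow> i \<le> size b \<longrightarrow> (i \<in> elems a \<longleftrightarrow> i \<in> elems b))"
proof (induction a b rule: mirrored.induct)
  case (3 a b)
  show ?case by (subst all_nat_Suc) (simp add: 3)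
next
  case (4 a b)
  show ?case by (subst all_nat_Suc) (auto simp: 4)
next
  case ("5_1" a b)
  have "\<not> (1 \<le> size (Out a) \<longrightarrow> 1 \<le> size (In b) \<longrightarrow> (1 \<in> elems (Out a) \<longleftrightarrow> 1 \<in> elems (In b)))" by simp
  then show ?case unfolding mirrored.simps by blast
next
  case ("5_2" a b)
  have "\<not> (1 \<le> size (In a) \<longrightarrow> 1 \<le> size (Out b) \<longrightarrow> (1 \<in> elems (In a) \<longleftrightarrow> 1 \<in> elems (Out b)))" by simp
  then show ?case unfolding mirrored.simps by blast
qed auto

section \<open>Correctness of the level-by-level search\<close>

lemma size_eq_0 [simp]: "size b = 0 \<longleftrightarrow> b = End" "0 = size b \<longleftrightarrow> b = End"
  for b :: bits
  by (cases b; simp)+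

lemma uniform_size: "uniform n t \<Longrightarrow> b \<in> keys t \<Longrightarrow> size b = n"
  by (induction t arbitrary: n b) auto

lemma wsum_cong: "(\<And>b. b \<in> keys t \<Longrightarrow> f b = g b) \<Longrightarrow> wsum f t = wsum g t"
proof (induction t arbitrary: f g)
  case (Node l r)
  show ?case using Node.IH[of "\<lambda>b. f (Out b)" "\<lambda>b. g (Out b)"] Node.IH(2)[of "\<lambda>b. f (In b)" "\<lambda>b. g (In b)"] Node.prems
    by simp
qed auto

text \<open>Counts have type \<open>num\<close> and are therefore positive, so no key is weighted by
  0.\<close>

lemma wsum_pos_iff: "0 < wsum f t \<longleftrightarrow> (\<exists>b\<in>keys t. 0 < f b)"
  by (induction t arbitrary: f) (auto simp: nat_of_num_pos)

lemma uniform_add_key: "size b = n \<Longrightarrow> uniform n t \<Longrightarrow> uniform n (add_key b c t)"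
  by (induction b c t arbitrary: n rule: add_key.induct) auto

lemma wsum_add_key:
  "size b = n \<Longrightarrow> uniform n t \<Longrightarrow> wsum h (add_key b c t) = nat_of_num c * h b + wsum h t"
proof (induction b c t arbitrary: n h rule: add_key.induct)
  case (2 b c l r)
  show ?case using "2.IH"[of "n - 1" "\<lambda>b. h (Out b)"] "2.prems" by simp
next
  case (3 b c l r)
  show ?case using "3.IH"[of "n - 1" "\<lambda>b. h (In b)"] "3.prems" by simp
next
  case (4 b c b' c')
  show ?case using "4.IH"[of "n - 1" "\<lambda>b. h (Out b)"] "4.prems" by simp
next
  case (5 b c b' c')
  show ?case using "5.IH"[of "n - 1" "\<lambda>b. h (In b)"] "5.prems" by simp
qed (auto simp: nat_of_num_add distrib_right)

lemma keys_add_key: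
  "size b = n \<Longrightarrow> uniform n t \<Longrightarrow> keys (add_key b c t) = insert b (keys t)"
  by (induction b c t arbitrary: n rule: add_key.induct) auto

lemma uniform_merge: "uniform n t \<Longrightarrow> uniform n u \<Longrightarrow> uniform n (merge t u)"
proof (induction t u arbitrary: n rule: merge.induct)
  case (4 l r b c)
  then show ?case unfolding merge.simps by (intro uniform_add_key) auto
qed (auto intro: uniform_add_key)

lemma wsum_merge: "uniform n t \<Longrightarrow> uniform n u \<Longrightarrow> wsum h (merge t u) = wsum h t + wsum h u"
proof (induction t u arbitrary: n h rule: merge.induct)
  case (4 l r b c)
  then show ?case unfolding merge.simps by (subst wsum_add_key[where n = n]) auto
next
  case (5 l r l' r')
  then show ?case by (simp add: 5(1)[of "n - 1"] 5(2)[of "n - 1"])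
qed (auto simp: wsum_add_key)

lemma keys_merge: "uniform n t \<Longrightarrow> uniform n u \<Longrightarrow> keys (merge t u) = keys t \<union> keys u"
proof (induction t u arbitrary: n rule: merge.induct)
  case (4 l r b c)
  then show ?case unfolding merge.simps by (subst keys_add_key[where n = n]) auto
next
  case (5 l r l' r')
  then show ?case by (auto simp: 5(1)[of "n - 1"] 5(2)[of "n - 1"])
qed (auto simp: keys_add_key)

section \<open>One move on bit strings and on tries\<close>

lemma uniform_successors: "uniform (size a + size b) (successors a b c)"
proof (induction b arbitrary: a)
  case (Out b)
  show ?case using Out[of "Out a"] by (cases "mirrored a b") (auto intro!: uniform_add_key)
next
  case (In b)
  show ?case using In[of "In a"] by simp
qed simp

text \<open>Since \<open>a\<close> is reversed, the numbers at distance \<open>d\<close> from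
  \<open>Suc (size a)\<close> are the \<open>d\<close>-th bits of \<open>a\<close> and of
  \<open>b\<close>.\<close>

lemma admits_Out:
  "admits (size (rev_append a (Out b))) (elems (rev_append a (Out b))) (Suc (size a)) \<longleftrightarrow> mirrored a b"
proof -
  have "(Suc (size a) - d \<in> elems (rev_append a (Out b)) \<longleftrightarrow> Suc (size a) + d \<in> elems (rev_append a (Out b)))
      \<longleftrightarrow> (d \<in> elems a \<longleftrightarrow> d \<in> elems b)" if "0 < d" "d < Suc (size a)" for d
    using that by (auto simp: mem_elems_rev_append Suc_diff_le)
  then show ?thesis unfolding mirrored_iff admits_def
    by (auto simp: mem_elems_rev_append) (metis gr0I le_imp_less_Suc zero_notin_elems)+
qed

lemma insert_elems_Out:
  "insert (Suc (size a)) (elems (rev_append a (Out b))) = elems (rev_append a (In b))"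
proof -
  have "x \<in> insert (Suc (size a)) (elems (rev_append a (Out b))) \<longleftrightarrow> x \<in> elems (rev_append a (In b))" for x
  proof (cases "x \<le> size a")
    case False
    then obtain y where "x = Suc (size a) + y" using less_imp_Suc_add[of "size a" x] by auto
    then show ?thesis by (cases y) (auto simp: mem_elems_rev_append)
  qed (auto simp: mem_elems_rev_append)
  then show ?thesis by blast
qed

text \<open>Scanning past a bit raises the bound \<open>size a < x\<close> by one; the position
  passed contributes exactly when its bit is \<open>Out\<close> and its two sides are
  mirrored.\<close>

lemma wsum_successors:
  fixes H :: "nat set \<Rightarrow> nat"
  shows "wsum (\<lambda>b. H (elems b)) (successors a b c) =
    nat_of_num c * (\<Sum>x | admits (size a + size b) (elems (rev_append a b)) x \<and> size a < x.
      H (insert x (elems (rev_append a b))))"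
proof (induction b arbitrary: a)
  case End
  have "{x. admits (size a + size End) (elems (rev_append a End)) x \<and> size a < x} = {}"
    by (auto simp: admits_def)
  then show ?case by (simp only: wsum.simps successors.simps sum.empty mult_0_right)
next
  case (Out b)
  let ?S = "elems (rev_append a (Out b))" and ?n = "size a + size (Out b)"
  have IH: "wsum (\<lambda>b. H (elems b)) (successors (Out a) b c) =
      nat_of_num c * (\<Sum>x | admits ?n ?S x \<and> Suc (size a) < x. H (insert x ?S))"
    using Out[of "Out a"] by simp
  have adm: "admits ?n ?S (Suc (size a)) \<longleftrightarrow> mirrored a b"
    using admits_Out[of a b] by simp
  show ?case
  proof (cases "mirrored a b")
    case True
    have "{x. admits ?n ?S x \<and> size a < x} = insert (Suc (size a)) {x. admits ?n ?S x \<and> Suc (size a) < x}"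
      using True adm by (auto simp: less_Suc_eq)
    then have "(\<Sum>x | admits ?n ?S x \<and> size a < x. H (insert x ?S))
        = H (elems (rev_append a (In b))) + (\<Sum>x | admits ?n ?S x \<and> Suc (size a) < x. H (insert x ?S))"
      by (simp add: insert_elems_Out)
    moreover have "uniform ?n (successors (Out a) b c)" using uniform_successors[of "Out a" b c] by simp
    ultimately show ?thesis using True
      by (simp add: wsum_add_key[where n = ?n] IH[simplified] algebra_simps)
  next
    case False
    have "{x. admits ?n ?S x \<and> size a < x} = {x. admits ?n ?S x \<and> Suc (size a) < x}"
      using False adm by (auto simp: less_Suc_eq) (metis Suc_lessI)
    then show ?thesis using False IH by simp
  qed
next
  case (In b)
  let ?S = "elems (rev_append a (In b))" and ?n = "size a + size (In b)"
  have "Suc (size a) \<in> ?S" by (simp add: mem_elems_rev_append)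
  then have "{x. admits ?n ?S x \<and> size a < x} = {x. admits ?n ?S x \<and> Suc (size a) < x}"
    by (auto simp: admits_def) (metis Suc_lessI)
  then show ?case using In[of "In a"] by simp
qed

lemma uniform_expand: "uniform m t \<Longrightarrow> uniform (size p + m) (expand p t)"
proof (induction t arbitrary: m p)
  case (Leaf b c)
  then show ?case using uniform_successors[of End "rev_append p b" c] by simp
next
  case (Node l r)
  then obtain k where m: "m = Suc k" "uniform k l" "uniform k r" by (cases m) auto
  then show ?case using Node.IH(1)[of k "Out p"] Node.IH(2)[of k "In p"]
    by (auto intro!: uniform_merge)
qed simp

lemma wsum_expand_prefix:
  fixes H :: "nat set \<Rightarrow> nat"
  assumes "uniform m t"
  shows "wsum (\<lambda>b. H (elems b)) (expand p t) =
    wsum (\<lambda>b. \<Sum>x | admits (size p + m) (elems (rev_append p b)) x. H (insert x (elems (rev_append p b)))) t"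
  using assms
proof (induction t arbitrary: m p)
  case (Leaf b c)
  have "{x. admits n S x \<and> 0 < x} = {x. admits n S x}" for n S by (auto simp: admits_def)
  with Leaf show ?case by (simp add: wsum_successors)
next
  case (Node l r)
  then obtain k where m: "m = Suc k" "uniform k l" "uniform k r" by (cases m) auto
  have "uniform (size p + m) (expand (Out p) l)" "uniform (size p + m) (expand (In p) r)"
    using uniform_expand[of k l "Out p"] uniform_expand[of k r "In p"] m by auto
  then show ?case using Node.IH(1)[of k "Out p"] Node.IH(2)[of k "In p"] m
    by (simp add: wsum_merge[where n = "size p + m"])
qed simp

lemma wsum_expand:
  fixes H :: "nat set \<Rightarrow> nat"
  assumes "uniform n t"
  shows "wsum (\<lambda>b. H (elems b)) (expand End t) =
    wsum (\<lambda>b. \<Sum>x | admits n (elems b) x. H (insert x (elems b))) t"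
  using wsum_expand_prefix[OF assms, of H End] by simp

lemma uniform_node: "uniform n l \<Longrightarrow> uniform n r \<Longrightarrow> uniform (Suc n) (node l r)"
  by (induction l r rule: node.induct) auto

lemma wsum_node: "wsum h (node l r) = wsum h (Node l r)"
  by (induction l r rule: node.induct) auto

lemma uniform_prune: "uniform n x \<Longrightarrow> uniform n (prune x s t)"
proof (induction x arbitrary: n s t)
  case (Leaf b c)
  then show ?case by (cases "admissible b s t") auto
next
  case (Node l r)
  then show ?case by (cases n) (auto intro: uniform_node)
qed simp

lemma wsum_prune: "wsum h (prune x s t) = wsum (\<lambda>b. of_bool (admissible b s t) * h b) x"
proof (induction x arbitrary: h s t)
  case (Leaf b c)
  then show ?case by (cases "admissible b s t") auto
qed (auto simp: wsum_node)

lemma uniform_next_level: "uniform n x \<Longrightarrow> uniform n (next_level s t x)"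
  using uniform_expand[of n x End] by (simp add: next_level_def uniform_prune)

text \<open>Carries the test from strings over to sets, so that it can serve as \<open>Q\<close> in
  \<open>completions\<close>.\<close>

definition admissible_set :: "nat \<Rightarrow> trie \<Rightarrow> trie \<Rightarrow> nat set \<Rightarrow> bool" where
  "admissible_set n s t S \<longleftrightarrow> (\<exists>b. size b = n \<and> elems b = S \<and> admissible b s t)"

lemma admissible_set_elems: "admissible_set (size b) s t (elems b) \<longleftrightarrow> admissible b s t"
  using elems_inj by (auto simp: admissible_set_def)

lemma wsum_next_level:
  fixes H :: "nat set \<Rightarrow> nat"
  assumes "uniform n x"
  shows "wsum (\<lambda>b. H (elems b)) (next_level s t x) =
    wsum (\<lambda>b. \<Sum>y | admits n (elems b) y. of_bool (admissible_set n s t (insert y (elems b))) * H (insert y (elems b))) x"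
proof -
  have u: "uniform n (expand End x)" using uniform_expand[OF assms, of End] by simp
  have "wsum (\<lambda>b. H (elems b)) (next_level s t x)
      = wsum (\<lambda>b. (\<lambda>S. of_bool (admissible_set n s t S) * H S) (elems b)) (expand End x)"
    unfolding next_level_def wsum_prune
    by (rule wsum_cong) (use admissible_set_elems uniform_size[OF u] in auto)
  also have "\<dots> = wsum (\<lambda>b. \<Sum>y | admits n (elems b) y.
      of_bool (admissible_set n s t (insert y (elems b))) * H (insert y (elems b))) x"
    by (rule wsum_expand[OF assms])
  finally show ?thesis .
qed

text \<open>Pulling a sum over the next level back to the present one, by
  \<open>wsum_next_level\<close>, is one unfolding of \<open>completions\<close>.\<close>

lemma wsum_advance:
  assumes "uniform n x"
  shows "wsum (\<lambda>_. 1) (advance k s t x)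
    = wsum (\<lambda>b. completions n (admissible_set n s t) k (elems b)) x"
  using assms
proof (induction k arbitrary: x)
  case (Suc k)
  then show ?case
    using wsum_next_level[of n x "completions n (admissible_set n s t) k" s t] by (simp add: uniform_next_level)
qed simp

text \<open>The sum formula, applied to the indicator of \<open>elems b'\<close>, has a positive
  summand at \<open>b\<close> and \<open>y\<close>.\<close>

lemma keys_next_level:
  assumes "uniform n x" "b \<in> keys x" "admits n (elems b) y" "elems b' = insert y (elems b)"
    "size b' = n" "admissible b' s t"
  shows "b' \<in> keys (next_level s t x)"
proof -
  have "0 < wsum (\<lambda>b. of_bool (elems b = elems b')) (next_level s t x)"
    unfolding wsum_next_level[OF assms(1), of "\<lambda>S. of_bool (S = elems b')"] wsum_pos_iff
  proof (intro bexI sum_pos2[where i = y])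
    show "b \<in> keys x" by fact
    show "0 < of_bool (admissible_set n s t (insert y (elems b))) * (of_bool (insert y (elems b) = elems b') :: nat)"
      using assms by (auto simp: admissible_set_def intro!: exI[of _ b'])
  qed (use assms in auto)
  then obtain c where "c \<in> keys (next_level s t x)" "elems c = elems b'" by (auto simp: wsum_pos_iff)
  moreover have "size c = n" using uniform_size[OF uniform_next_level[OF assms(1)]] calculation by blast
  ultimately show ?thesis using elems_inj assms by metis
qed

lemma keys_forget_counts [simp]: "keys (forget_counts x) = keys x"
  by (induction x) auto

lemma uniform_forget_counts [simp]: "uniform n (forget_counts x) = uniform n x"
  by (induction x arbitrary: n) auto

lemma uniform_visited: "uniform n x \<Longrightarrow> uniform n (visited k s t x)"
proof (induction k arbitrary: x)
  case (Suc k)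
  then show ?case by (simp add: uniform_merge uniform_next_level)
qed simp

lemma card_moves: "(move n)\<^sup>*\<^sup>* S T \<Longrightarrow> finite S \<Longrightarrow> finite T \<and> card S \<le> card T"
  by (induction rule: rtranclp_induct) (auto simp: move_def card_insert_if)

text \<open>Every set on a path from \<open>elems b\<close> to the live set \<open>elems d\<close>
  is live and thus survives the pruning. Each move adds one element, so \<open>k\<close> levels
  suffice.\<close>

lemma keys_visited:
  assumes "uniform n x" "b \<in> keys x" "(move n)\<^sup>*\<^sup>* {} (elems b)" "(move n)\<^sup>*\<^sup>* (elems b) (elems d)"
    "live n (elems d)" "size d = n" "card (elems d) \<le> card (elems b) + k"
    and adm: "\<And>c. size c = n \<Longrightarrow> live n (elems c) \<Longrightarrow> admissible c s t"
  shows "d \<in> keys (visited k s t x)"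
  using assms(1-7)
proof (induction k arbitrary: x b)
  case 0
  have fin: "finite (elems b)" by (meson elems_subset finite_atLeastAtMost finite_subset)
  \<comment> \<open>A first move would already make the cardinality exceed that of
    \<open>elems b\<close>.\<close>
  have "elems b = elems d"
    using 0(4)
  proof (cases rule: converse_rtranclpE)
    case (step T)
    then have "card (elems b) < card T" using fin by (auto simp: move_def admits_def)
    moreover have "finite T" using step fin by (auto simp: move_def)
    ultimately show ?thesis using card_moves[OF step(2)] 0 by simp
  qed
  then show ?case using 0 elems_inj uniform_size by (metis keys_forget_counts visited.simps(1))
next
  case (Suc k)
  have fin: "finite (elems b)" by (meson elems_subset finite_atLeastAtMost finite_subset)
  have keys: "keys (visited (Suc k) s t x) = keys x \<union> keys (visited k s t (next_level s t x))"
    using Suc.prems(1) by (simp add: keys_merge[where n = n] uniform_visited uniform_next_level)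
  show ?case
    using Suc.prems(4)
  proof (cases rule: converse_rtranclpE)
    case base
    then have "b = d" using Suc.prems uniform_size elems_inj by metis
    then show ?thesis using keys Suc.prems by simp
  next
    case (step T)
    then obtain y where y: "admits n (elems b) y" "T = insert y (elems b)" by (auto simp: move_def)
    have reach: "(move n)\<^sup>*\<^sup>* {} T" using Suc.prems(3) step(1) by (rule rtranclp.rtrancl_into_rtrancl)
    then have "T \<subseteq> {1..n}" using move_subset by blast
    then obtain c where c: "size c = n" "elems c = T" using ex_bits by blast
    have "live n (elems c)" using live_between[OF reach step(2)] Suc.prems(5) c(2) by simp
    then have "admissible c s t" using adm c(1) by blast
    with c y(2) have "c \<in> keys (next_level s t x)"
      by (intro keys_next_level[OF Suc.prems(1,2) y(1)]) simp_all
    moreover have "card T = Suc (card (elems b))" using y fin by (simp add: admits_def)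
    then have "card (elems d) \<le> card (elems c) + k" using Suc.prems(7) c(2) by simp
    moreover have "(move n)\<^sup>*\<^sup>* {} (elems c)" "(move n)\<^sup>*\<^sup>* (elems c) (elems d)"
      using reach step(2) c(2) by simp_all
    ultimately have "d \<in> keys (visited k s t (next_level s t x))"
      using Suc.IH[of "next_level s t x" c] Suc.prems(5,6) uniform_next_level[OF Suc.prems(1)] by blast
    then show ?thesis using keys by simp
  qed
qed

text \<open>The complements of the odd and the even trace. Removing the first bit shifts all
  positions by one, so the two functions exchange roles.\<close>

fun co_odds :: "bits \<Rightarrow> bits" and co_evens :: "bits \<Rightarrow> bits" where
  "co_odds End = End"
| "co_odds (Out b) = In (co_evens b)"
| "co_odds (In b) = Out (co_evens b)"
| "co_evens End = End"
| "co_evens (Out b) = co_odds b"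
| "co_evens (In b) = co_odds b"

lemma size_co_odds: "size (co_odds b) = (size b + 1) div 2"
  and size_co_evens: "size (co_evens b) = size b div 2"
  by (induction b) auto

lemma mem_co_odds: "i \<in> elems (co_odds b) \<longleftrightarrow> 1 \<le> i \<and> 2 * i \<le> size b + 1 \<and> 2 * i - 1 \<notin> elems b"
  and mem_co_evens: "i \<in> elems (co_evens b) \<longleftrightarrow> 1 \<le> i \<and> 2 * i \<le> size b \<and> 2 * i \<notin> elems b"
proof (induction b arbitrary: i)
  case (Out b)
  {
    case 1
    show ?case using Out(2)[of "i - 1"] by (cases i) auto
  next
    case 2
    show ?case using Out(1)[of i] by (cases i) auto
  }
next
  case (In b)
  {
    case 1
    show ?case using In(2)[of "i - 1"] by (cases i) auto
  next
    case 2
    show ?case using In(1)[of i] by (cases i) auto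
  }
qed auto

lemma in_child_keys: "In b \<in> keys t \<Longrightarrow> b \<in> keys (in_child t)"
  by (induction t rule: in_child.induct) auto

lemma out_child_keys: "Out b \<in> keys t \<Longrightarrow> b \<in> keys (out_child t)"
  by (induction t rule: out_child.induct) auto

text \<open>\<open>admissible\<close> follows \<open>co_odds b\<close> through \<open>s\<close> and
  \<open>co_evens b\<close> through \<open>t\<close>.\<close>

lemma admissibleI: "co_odds b \<in> keys s \<Longrightarrow> co_evens b \<in> keys t \<Longrightarrow> admissible b s t"
proof (induction b arbitrary: s t)
  case End
  then show ?case by (cases s; cases t) auto
qed (auto intro: out_child_keys in_child_keys)

text \<open>One inclusion is enough: by \<open>completions_prune\<close>, further keys cost time but
  leave the count unchanged.\<close>

definition covers :: "nat \<Rightarrow> trie \<Rightarrow> bool" where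
  "covers n t \<longleftrightarrow> (\<forall>b. size b = n \<longrightarrow> live n (elems b) \<longrightarrow> b \<in> keys t)"

text \<open>The complement of a live set is live, and so are its odd and even traces, which are the
  keys looked up.\<close>

lemma live_imp_admissible:
  assumes s: "covers ((n + 1) div 2) s" and t: "covers (n div 2) t"
    and b: "size b = n" "live n (elems b)"
  shows "admissible b s t"
proof (rule admissibleI)
  have live: "live n ({1..n} - elems b)" using live_complement b(2) .
  let ?m = "(n + 1) div 2"
  have "live ?m {i \<in> {1..?m}. 2 * i - 1 \<in> {1..n} - elems b}"
    by (rule live_restrict[OF _ _ _ live, where r = 1]) auto
  also have "{i \<in> {1..?m}. 2 * i - 1 \<in> {1..n} - elems b} = elems (co_odds b)"
    using b by (auto simp: mem_co_odds)
  finally show "co_odds b \<in> keys s" using s b by (simp add: covers_def size_co_odds)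
  let ?m = "n div 2"
  have "live ?m {i \<in> {1..?m}. 2 * i \<in> {1..n} - elems b}"
    by (rule live_restrict[OF _ _ _ live, where r = 0]) auto
  also have "{i \<in> {1..?m}. 2 * i \<in> {1..n} - elems b} = elems (co_evens b)"
    using b by (auto simp: mem_co_evens)
  finally show "co_evens b \<in> keys t" using t b by (simp add: covers_def size_co_evens)
qed

text \<open>For \<open>2 \<le> n\<close> both halves are smaller than \<open>n\<close>, and a live
  set is reached from the empty set, \<open>out_bits n\<close>, within \<open>n\<close>
  levels.\<close>

lemma covers_states: "covers n (states n)"
proof (induction n rule: states.induct)
  case (1 n)
  consider "n = 0" | "n = 1" | "2 \<le> n" by linarith
  then show ?case
  proof cases
    case 1
    have "b = End" if "size b = 0" for b using that by (cases b) auto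
    then show ?thesis using 1 by (auto simp: covers_def states.simps[of 0])
  next
    case 2
    have "b = Out End \<or> b = In End" if "size b = 1" for b
    proof (cases b)
      case (Out c) then show ?thesis using that by (cases c) auto
    next
      case (In c) then show ?thesis using that by (cases c) auto
    qed (use that in auto)
    then show ?thesis using 2 by (auto simp: covers_def states.simps[of "Suc 0"])
  next
    case 3
    have IH: "covers ((n + 1) div 2) (states ((n + 1) div 2))" "covers (n div 2) (states (n div 2))"
      using 1 3 by auto
    have "b \<in> keys (visited n (states ((n + 1) div 2)) (states (n div 2)) (Leaf (out_bits n) num.One))"
      if b: "size b = n" "live n (elems b)" for b
    proof (rule keys_visited[where n = n and b = "out_bits n"])
      show "(move n)\<^sup>*\<^sup>* (elems (out_bits n)) (elems b)" using b by (simp add: live_def)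
      show "card (elems b) \<le> card (elems (out_bits n)) + n"
        using card_mono[OF _ elems_subset[of b]] b by simp
    qed (use b live_imp_admissible[OF IH] in auto)
    then show ?thesis using 3 by (simp add: covers_def states.simps[of n])
  qed
qed

lemma theta_eq_wsum:
  "\<theta> n = wsum (\<lambda>_. 1) (advance n (states ((n + 1) div 2)) (states (n div 2)) (Leaf (out_bits n) num.One))"
proof -
  let ?s = "states ((n + 1) div 2)" and ?t = "states (n div 2)"
  have "\<theta> n = completions n (admissible_set n ?s ?t) n {}"
  proof (rule theta_eq_pruned)
    fix T assume T: "live n T"
    then have "T \<subseteq> {1..n}" using move_subset[of n "{}" T] by (simp add: live_def)
    then obtain b where "size b = n" "elems b = T" using ex_bits by blast
    then show "admissible_set n ?s ?t T"
      using live_imp_admissible[OF covers_states covers_states] T by (auto simp: admissible_set_def)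
  qed
  also have "\<dots> = wsum (\<lambda>_. 1) (advance n ?s ?t (Leaf (out_bits n) num.One))"
    by (subst wsum_advance[where n = n]) simp_all
  finally show ?thesis .
qed

section \<open>Evaluation\<close>

text \<open>\<open>wsum\<close> for the constant 1 without the function argument, to be computed by
  rewriting on numerals.\<close>

primrec total_count :: "trie \<Rightarrow> nat" where
  "total_count Empty = 0"
| "total_count (Leaf b c) = numeral c"
| "total_count (Node l r) = total_count l + total_count r"

lemma wsum_one: "wsum (\<lambda>_. 1) t = total_count t"
  by (induction t) (simp_all add: nat_of_num_numeral)

lemmas theta_eq_total_count = theta_eq_wsum[unfolded wsum_one]

lemma states_rec:
  "2 \<le> n \<Longrightarrow> states n = visited n (states ((n + 1) div 2)) (states (n div 2)) (Leaf (out_bits n) num.One)"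
  by (subst states.simps) auto

lemma states_1: "states (Suc 0) = Node (Leaf End num.One) (Leaf End num.One)"
  by (subst states.simps) auto

lemma numeral_rec:
  "out_bits (numeral k) = Out (out_bits (pred_numeral k))"
  "advance (numeral k) s t x = advance (pred_numeral k) s t (next_level s t x)"
  "visited (numeral k) s t x = merge (forget_counts x) (visited (pred_numeral k) s t (next_level s t x))"
  by (simp_all add: numeral_eq_Suc)

text \<open>Lets a lookup fail as soon as one of the tries is exhausted, before the end of the
  string.\<close>

lemma admissible_Empty: "admissible b Empty t = False" "admissible b t Empty = False"
proof -
  have "\<not> admissible b Empty t \<and> \<not> admissible b t Empty" by (induction b arbitrary: t) auto
  then show "admissible b Empty t = False" "admissible b t Empty = False" by auto
qed

text \<open>The recursion of \<open>states\<close> is instantiated at 2 to 11 and at 20, the sizes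
  to which repeated halving of 11 to 21 and of 40 leads; size 1 is covered by
  \<open>states_1\<close>.\<close>

lemmas eval_rules =
  out_bits.simps(1) advance.simps(1) visited.simps(1) numeral_rec next_level_def
  pred_numeral_simps BitM.simps add_num_simps total_count.simps simp_thms
  add_key.simps merge.simps mirrored.simps rev_append.simps add_if.simps successors.simps
  expand.simps out_child.simps in_child.simps nonempty.simps admissible_Empty admissible.simps
  node.simps leaf_if.simps prune.simps forget_counts.simps
  states_1 states_rec[of 2, simplified] states_rec[of 3, simplified] states_rec[of 4, simplified] states_rec[of 5, simplified]
  states_rec[of 6, simplified] states_rec[of 7, simplified] states_rec[of 8, simplified]
  states_rec[of 9, simplified] states_rec[of 10, simplified] states_rec[of 11, simplified]
  states_rec[of 20, simplified]

text \<open>The base range, from 11 up to but excluding 22, of the induction for the exponential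
  bound.\<close>

lemma theta_small:
  "\<theta> 11 = 2460"
  "\<theta> 12 = 6128"
  "\<theta> 13 = 12840"
  "\<theta> 14 = 29380"
  "\<theta> 15 = 74904"
  "\<theta> 16 = 212728"
  "\<theta> 17 = 368016"
  "\<theta> 18 = 659296"
  "\<theta> 19 = 1371056"
  "\<theta> 20 = 2937136"
  "\<theta> 21 = 6637232"
  by (simp_all only: eval_rules
      theta_eq_total_count[of 11, simplified] theta_eq_total_count[of 12, simplified] theta_eq_total_count[of 13, simplified]
      theta_eq_total_count[of 14, simplified] theta_eq_total_count[of 15, simplified] theta_eq_total_count[of 16, simplified]
      theta_eq_total_count[of 17, simplified] theta_eq_total_count[of 18, simplified] theta_eq_total_count[of 19, simplified]
      theta_eq_total_count[of 20, simplified] theta_eq_total_count[of 21, simplified])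

lemma theta_40: "\<theta> 40 = 22388184630824"
  by (simp only: eval_rules theta_eq_total_count[of 40, simplified])

section \<open>Exponential growth\<close>

text \<open>The outer terms of a progression have an even sum, so they lie in the same block, and
  the middle position lies between them.\<close>

lemma three_free_append:
  assumes "three_free us" "three_free vs" "\<And>u v. u \<in> set us \<Longrightarrow> v \<in> set vs \<Longrightarrow> odd (u + v)"
  shows "three_free (us @ vs)"
  unfolding three_free_def
proof (clarify)
  fix i j k assume ijk: "i < j" "j < k" "k < length (us @ vs)"
    and eq: "(us @ vs) ! i + (us @ vs) ! k = 2 * (us @ vs) ! j"
  consider "k < length us" | "i < length us" "length us \<le> k" | "length us \<le> i" using ijk by linarith
  then show False
  proof cases
    case 1
    then show ?thesis using assms(1) ijk eq by (auto simp: three_free_def nth_append)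
  next
    case 2
    then have "odd ((us @ vs) ! i + (us @ vs) ! k)"
      using assms(3)[of "us ! i" "vs ! (k - length us)"] ijk by (simp add: nth_append)
    then show ?thesis using eq by simp
  next
    case 3
    then have "i - length us < j - length us" "j - length us < k - length us" "k - length us < length vs"
      using ijk by auto
    then have "vs ! (i - length us) + vs ! (k - length us) \<noteq> 2 * vs ! (j - length us)"
      using assms(2) unfolding three_free_def by blast
    then show ?thesis using 3 ijk eq by (simp add: nth_append)
  qed
qed

text \<open>An injective affine map reflects progressions; entries at least 1 keep the subtraction
  exact.\<close>

lemma three_free_map:
  assumes "three_free xs" "set xs \<subseteq> {1..}" "r \<le> 1"
  shows "three_free (map (\<lambda>i. 2 * i - r) xs)"
  unfolding three_free_def
proof (clarify)
  fix i j k assume ijk: "i < j" "j < k" "k < length (map (\<lambda>i. 2 * i - r) xs)"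
    and eq: "map (\<lambda>i. 2 * i - r) xs ! i + map (\<lambda>i. 2 * i - r) xs ! k = 2 * map (\<lambda>i. 2 * i - r) xs ! j"
  have ge: "1 \<le> xs ! l" if "l < length xs" for l using assms(2) nth_mem[OF that] by auto
  have "(2 * xs ! i - r) + (2 * xs ! k - r) = 2 * (2 * xs ! j - r)" using ijk eq by simp
  then have "xs ! i + xs ! k = 2 * xs ! j"
    using ge[of i] ge[of j] ge[of k] ijk assms(3) by simp
  then show False using assms(1) ijk by (auto simp: three_free_def)
qed

text \<open>Odd entries before even ones, or conversely: two disjoint families, each indexed by
  pairs of 3-free permutations of the halves.\<close>

lemma theta_superadditive:
  assumes "2 \<le> n"
  shows "2 * \<theta> ((n + 1) div 2) * \<theta> (n div 2) \<le> \<theta> n"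
proof -
  define T where "T = (\<lambda>n. {a \<in> permutations_of_set {1..n}. three_free a})"
  define m k where "m = (n + 1) div 2" and "k = n div 2"
  define od where "od = map (\<lambda>i. 2 * i - (1::nat))"
  \<comment> \<open>Subtracting 0 matches the form of \<open>three_free_map\<close> with
    \<open>r = 0\<close>.\<close>
  define ev where "ev = map (\<lambda>i. 2 * i - (0::nat))"
  have fin: "finite (T i)" for i by (simp add: T_def)
  have T: "three_free xs" "set xs = {1..i}" "distinct xs" "length xs = i" if "xs \<in> T i" for xs i
    using that by (auto simp: T_def permutations_of_set_def dest: distinct_card)
  have union: "{1..n} = (\<lambda>i. 2 * i - 1) ` {1..m} \<union> (\<lambda>i. 2 * i - 0) ` {1..k}"
  proof -
    have "x \<in> (\<lambda>i. 2 * i - 1) ` {1..m} \<union> (\<lambda>i. 2 * i - 0) ` {1..k}" if "x \<in> {1..n}" for x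
    proof (cases "even x")
      case True
      then show ?thesis using that by (intro UnI2 image_eqI[of _ _ "x div 2"]) (auto simp: k_def)
    next
      case False
      then show ?thesis using that by (intro UnI1 image_eqI[of _ _ "(x + 1) div 2"]) (auto simp: m_def elim!: oddE)
    qed
    moreover have "(\<lambda>i. 2 * i - 1) ` {1..m} \<union> (\<lambda>i. 2 * i - 0) ` {1..k} \<subseteq> {1..n}"
      by (auto simp: m_def k_def)
    ultimately show ?thesis by blast
  qed
  have inj: "inj_on (\<lambda>i. 2 * i - (1::nat)) {1..m}" "inj_on (\<lambda>i. 2 * i - (0::nat)) {1..k}"
    by (auto simp: inj_on_def)
  have parts: "three_free (od us)" "three_free (ev vs)" "distinct (od us)" "distinct (ev vs)"
      "set (od us) = (\<lambda>i. 2 * i - 1) ` {1..m}" "set (ev vs) = (\<lambda>i. 2 * i - 0) ` {1..k}"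
      "\<And>x. x \<in> set (od us) \<Longrightarrow> odd x" "\<And>x. x \<in> set (ev vs) \<Longrightarrow> even x"
    if "us \<in> T m" "vs \<in> T k" for us vs
    using T[OF that(1)] T[OF that(2)] inj three_free_map[of us 1] three_free_map[of vs 0]
    by (auto simp: od_def ev_def distinct_map)
  define A where "A = (\<lambda>(us, vs). od us @ ev vs) ` (T m \<times> T k)"
  define B where "B = (\<lambda>(us, vs). ev vs @ od us) ` (T m \<times> T k)"
  have eq_odI: "us = us'" if "od us = od us'" "us \<in> T m" "us' \<in> T m" for us us'
    using that inj(1) T(2) by (auto simp: od_def dest!: map_inj_on)
  have eq_evI: "vs = vs'" if "ev vs = ev vs'" "vs \<in> T k" "vs' \<in> T k" for vs vs'
    using that inj(2) T(2) by (auto simp: ev_def dest!: map_inj_on)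
  have "inj_on (\<lambda>(us, vs). od us @ ev vs) (T m \<times> T k)"
  proof (rule inj_onI, clarify)
    fix us vs us' vs' assume *: "us \<in> T m" "us' \<in> T m" "vs \<in> T k" "vs' \<in> T k"
      and "od us @ ev vs = od us' @ ev vs'"
    moreover have "length (od us) = length (od us')" "length (ev vs) = length (ev vs')"
      using *[THEN T(4)] by (simp_all add: od_def ev_def)
    ultimately have "od us = od us'" "ev vs = ev vs'" by simp_all
    then show "us = us' \<and> vs = vs'" using eq_odI eq_evI * by blast
  qed
  then have cA: "card A = \<theta> m * \<theta> k"
    by (simp add: A_def card_image card_cartesian_product T_def theta_def)
  have "inj_on (\<lambda>(us, vs). ev vs @ od us) (T m \<times> T k)"
  proof (rule inj_onI, clarify)
    fix us vs us' vs' assume *: "us \<in> T m" "us' \<in> T m" "vs \<in> T k" "vs' \<in> T k"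
      and "ev vs @ od us = ev vs' @ od us'"
    moreover have "length (od us) = length (od us')" "length (ev vs) = length (ev vs')"
      using *[THEN T(4)] by (simp_all add: od_def ev_def)
    ultimately have "od us = od us'" "ev vs = ev vs'" by simp_all
    then show "us = us' \<and> vs = vs'" using eq_odI eq_evI * by blast
  qed
  then have cB: "card B = \<theta> m * \<theta> k"
    by (simp add: B_def card_image card_cartesian_product T_def theta_def)
  have "A \<inter> B = {}"
  proof -
    \<comment> \<open>The parity of the first entry tells the two orders apart;
      \<open>2 \<le> n\<close> makes both parts nonempty.\<close>
    have "odd (hd xs)" if xs: "xs \<in> A" for xs
    proof -
      obtain us vs where *: "us \<in> T m" "vs \<in> T k" "xs = od us @ ev vs" using xs by (auto simp: A_def)
      have "od us \<noteq> []" using T(4)[OF *(1)] assms by (auto simp: od_def m_def)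
      then show ?thesis using parts(7)[OF *(1,2)] * by simp
    qed
    moreover have "even (hd xs)" if xs: "xs \<in> B" for xs
    proof -
      obtain us vs where *: "us \<in> T m" "vs \<in> T k" "xs = ev vs @ od us" using xs by (auto simp: B_def)
      have "ev vs \<noteq> []" using T(4)[OF *(2)] assms by (auto simp: ev_def k_def)
      then show ?thesis using parts(8)[OF *(1,2)] * by simp
    qed
    ultimately show ?thesis by blast
  qed
  moreover have "finite A" "finite B" by (auto simp: A_def B_def fin)
  ultimately have "2 * \<theta> m * \<theta> k = card (A \<union> B)"
    by (simp add: card_Un_disjoint cA cB)
  also have "A \<union> B \<subseteq> T n"
  proof -
    have "od us @ ev vs \<in> T n \<and> ev vs @ od us \<in> T n" if *: "us \<in> T m" "vs \<in> T k" for us vs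
    proof -
      note p = parts[OF *]
      have "three_free (od us @ ev vs)" "three_free (ev vs @ od us)"
        using p by (auto intro!: three_free_append simp del: set_map)
      moreover have "set (od us) \<inter> set (ev vs) = {}" using p(7,8) by blast
      ultimately show ?thesis using p(3-6) union
        by (auto simp: T_def permutations_of_set_def)
    qed
    then show ?thesis by (auto simp: A_def B_def)
  qed
  then have "card (A \<union> B) \<le> card (T n)" by (intro card_mono fin)
  finally show ?thesis by (simp add: T_def theta_def m_def k_def)
qed

text \<open>From \<open>2 * N\<close> on, both halves of \<open>n\<close> are at least
  \<open>N\<close>, and the factor 2 makes the bounds for the halves multiply to the bound for
  \<open>n\<close>.\<close>

lemma superadditive_exponential:
  fixes \<beta> :: real
  assumes "0 \<le> \<beta>" "1 \<le> N" and base: "\<And>n. N \<le> n \<Longrightarrow> n < 2 * N \<Longrightarrow> \<beta> ^ n \<le> 2 * real (\<theta> n)"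
  shows "N \<le> n \<Longrightarrow> \<beta> ^ n \<le> 2 * real (\<theta> n)"
proof (induction n rule: less_induct)
  case (less n)
  show ?case
  proof (cases "n < 2 * N")
    case False
    let ?m = "(n + 1) div 2" and ?k = "n div 2"
    have lt: "?m < n" "?k < n" "N \<le> ?m" "N \<le> ?k" "?m + ?k = n" "2 \<le> n" using False assms(2) by auto
    have "\<beta> ^ n = \<beta> ^ ?m * \<beta> ^ ?k" using lt(5) by (metis power_add)
    also have "\<dots> \<le> (2 * real (\<theta> ?m)) * (2 * real (\<theta> ?k))"
      using less.IH lt assms(1) by (intro mult_mono) auto
    also have "\<dots> = 2 * real (2 * \<theta> ?m * \<theta> ?k)" by simp
    also have "\<dots> \<le> 2 * real (\<theta> n)" using theta_superadditive[OF lt(6)] by linarith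
    finally show ?thesis .
  qed (use less base in auto)
qed

text \<open>With \<open>y ^ p = 1 / c\<close> the reciprocal is \<open>(n * y ^ n) ^ p\<close>,
  which tends to 0 through positive values because \<open>0 < y < 1\<close>.\<close>

lemma exponential_over_power_at_top:
  fixes c :: real
  assumes "1 < c" "0 < p"
  shows "filterlim (\<lambda>n. c ^ n / real n ^ p) at_top sequentially"
proof -
  define y where "y = root p (1 / c)"
  have y: "0 < y" "y < 1" "y ^ p = 1 / c" using assms by (auto simp: y_def)
  have "(\<lambda>n. real n * y ^ n) \<longlonglongrightarrow> 0" using y by (intro powser_times_n_limit_0) auto
  then have "(\<lambda>n. (real n * y ^ n) ^ p) \<longlonglongrightarrow> 0"
    using assms(2) by (auto dest: tendsto_power[where n = p])
  moreover have "eventually (\<lambda>n. 0 < (real n * y ^ n) ^ p) sequentially"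
    using eventually_gt_at_top[of 0] by eventually_elim (use y in auto)
  ultimately have "filterlim (\<lambda>n. inverse ((real n * y ^ n) ^ p)) at_top sequentially"
    by (rule filterlim_inverse_at_top)
  moreover have "inverse ((real n * y ^ n) ^ p) = c ^ n / real n ^ p" for n
  proof -
    have "(real n * y ^ n) ^ p = real n ^ p * (y ^ p) ^ n"
      by (simp add: power_mult_distrib flip: power_mult) (simp add: mult.commute)
    then show ?thesis using y(3) by (simp add: power_one_over field_simps)
  qed
  ultimately show ?thesis by simp
qed

theorem theorem12:
  fixes \<alpha> :: real
  assumes "\<alpha> = root 40 (real (\<theta> 40))"
  shows "\<theta> 40 = 22388184630824 \<and>
    (\<forall>p::nat. p \<ge> 5 \<longrightarrow>
      filterlim (\<lambda>n::nat. real (\<theta> n) / (real n ^ p * \<alpha> ^ n)) at_top sequentially)"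
proof -
  \<comment> \<open>Any value works that lies above \<open>\<alpha>\<close>, about 2.1565, and below
    the \<open>n\<close>-th roots of \<open>2 * \<theta> n\<close> for \<open>n\<close> from 11 to
    21, the least being about 2.1659 at 11.\<close>
  define \<beta> :: real where "\<beta> = 2158 / 1000"
  have \<alpha>: "0 < \<alpha>" "\<alpha> ^ 40 = 22388184630824" using assms theta_40 by simp_all
  have "\<alpha> ^ 40 < \<beta> ^ 40" unfolding \<alpha> \<beta>_def by (simp add: power_divide)
  then have "\<alpha> < \<beta>" by (rule power_less_imp_less_base) (simp add: \<beta>_def)
  then have c: "1 < \<beta> / \<alpha>" using \<alpha> by simp
  have growth: "\<beta> ^ n \<le> 2 * real (\<theta> n)" if "11 \<le> n" for n
  proof (rule superadditive_exponential[OF _ _ _ that])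
    fix n :: nat assume "11 \<le> n" "n < 2 * 11"
    then have "n \<in> {11, 12, 13, 14, 15, 16, 17, 18, 19, 20, 21}"
      by (simp only: insert_iff empty_iff) arith
    then show "\<beta> ^ n \<le> 2 * real (\<theta> n)"
      by (auto simp: theta_small \<beta>_def power_divide)
  qed (auto simp: \<beta>_def)
  have "filterlim (\<lambda>n::nat. real (\<theta> n) / (real n ^ p * \<alpha> ^ n)) at_top sequentially" if "p \<ge> 5" for p :: nat
  proof -
    \<comment> \<open>The minorant comes from replacing \<open>\<theta> n\<close> by its lower bound
      \<open>\<beta> ^ n / 2\<close>.\<close>
    have "filterlim (\<lambda>n. 1 / 2 * ((\<beta> / \<alpha>) ^ n / real n ^ p)) at_top sequentially"
      using exponential_over_power_at_top[OF c, of p] that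
      by (intro filterlim_tendsto_pos_mult_at_top[OF tendsto_const]) auto
    then show ?thesis
    proof (rule filterlim_at_top_mono)
      show "eventually (\<lambda>n. 1 / 2 * ((\<beta> / \<alpha>) ^ n / real n ^ p) \<le> real (\<theta> n) / (real n ^ p * \<alpha> ^ n)) sequentially"
        using eventually_ge_at_top[of 11]
      proof eventually_elim
        case (elim n)
        have "1 / 2 * ((\<beta> / \<alpha>) ^ n / real n ^ p) = (\<beta> ^ n / 2) / (real n ^ p * \<alpha> ^ n)"
          by (simp add: power_divide)
        also have "\<dots> \<le> real (\<theta> n) / (real n ^ p * \<alpha> ^ n)"
          using growth[OF elim] \<alpha>(1) by (intro divide_right_mono) auto
        finally show ?case .
      qed
    qed
  qed
  then show ?thesis using theta_40 by blast
qed

end
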